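(* Let $\gamma$ be a smooth closed curve in $\mathbb{R}^4$ whose curvatures $k_1,k_2,k_3$ are constant and non-vanishing. Let $\tilde\gamma\subset\mathbb{R}^6$ be the osculating indicatrix of $\gamma$. Then: 1) $\tilde\gamma$ is a smooth closed curve; 2) $\tilde\gamma$ is contained in a four-dimensional affine plane $\mathbb{R}^4\subset\mathbb{R}^6$; 3) the curvatures $\tilde k_1,\tilde k_2,\tilde k_3$ of $\tilde\gamma$ (as a curve in this four-dimensional affine plane) are constant and non-vanishing; 4) $$\int_{\tilde\gamma}\tilde k_1\,d\tilde s=\int_\gamma\sqrt{k_1^2+k_2^2+k_3^2}\,ds;$$ 5) $$\int_{\tilde\gamma}\sqrt{\tilde k_1^2+\tilde k_2^2+\tilde k_3^2}\,d\tilde s=\sqrt2\int_\gamma\sqrt{k_1^2+k_2^2+k_3^2}\,ds.$$ Here $s$ and $\tilde s$ denote the arc lengths of $\gamma$ and $\tilde\gamma$ respectively.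
   Context: A smooth closed curve in a Euclidean space is a regular $C^\infty$ parametrized curve (nowhere vanishing velocity) that is periodic in its parameter; integrals over $\gamma$ are taken over one minimal period. Curvatures: for a regular curve in a four-dimensional Euclidean (affine) space, with arc-length parameter $s$ and Frenet frame $e_1,\dots,e_4$ obtained by Gram--Schmidt orthonormalization of the first four derivatives with respect to $s$ (linearly independent when all curvatures are non-vanishing), the curvatures are $k_i=\langle \frac{de_i}{ds},e_{i+1}\rangle$, $i=1,2,3$; with this convention non-vanishing curvatures are positive. Osculating indicatrix: let $\gamma$ have position vector $x(t)=(x_1(t),\dots,x_4(t))$ and non-vanishing $k_1,k_2$. The oriented osculating plane at $x(t)$ is spanned by $\frac{dx}{dt},\frac{d^2x}{dt^2}$ (equivalently by the first two Frenet vectors); via Plücker coordinates it gives a point of the Grassmann manifold $G(2,4)\subset\mathbb{R}^6$. Thus the osculating indicatrix $\tilde\gamma$ is the parametrized curve in $\mathbb{R}^6$ (with its standard Euclidean metric) $$\tilde x(t)=\frac{\left[\frac{dx}{dt},\frac{d^2x}{dt^2}\right]}{\left|\left[\frac{dx}{dt},\frac{d^2x}{dt^2}\right]\right|},\qquad \left[\tfrac{dx}{dt},\tfrac{d^2x}{dt^2}\right]=(\tilde x_{12},\tilde x_{13},\tilde x_{14},\tilde x_{23},\tilde x_{24},\tilde x_{34}),\qquad \tilde x_{ij}=\frac{dx_i}{dt}\frac{d^2x_j}{dt^2}-\frac{dx_j}{dt}\frac{d^2x_i}{dt^2}.$$ The curve $\tilde\gamma$ is generated by letting the point move once along $\gamma$,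 so integrals over $\tilde\gamma$ are taken with $t$ running over one minimal period of $\gamma$. *)

theory Defs
  imports "HOL-Analysis.Analysis"
begin

definition curve_deriv :: "(real \<Rightarrow> 'a::euclidean_space) \<Rightarrow> real \<Rightarrow> 'a" where
  "curve_deriv c t = vector_derivative c (at t)"

definition smooth_curve :: "(real \<Rightarrow> 'a::euclidean_space) \<Rightarrow> bool" where
  "smooth_curve c \<longleftrightarrow> (\<forall>n t. (curve_deriv ^^ n) c differentiable (at t))"

definition regular_curve :: "(real \<Rightarrow> 'a::euclidean_space) \<Rightarrow> bool" where
  "regular_curve c \<longleftrightarrow> (\<forall>t. curve_deriv c t \<noteq> 0)"

definition is_period :: "(real \<Rightarrow> 'a) \<Rightarrow> real \<Rightarrow> bool" where
  "is_period c T \<longleftrightarrow> T > 0 \<and> (\<forall>t. c (t + T) = c t)"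

definition smooth_closed_curve :: "(real \<Rightarrow> 'a::euclidean_space) \<Rightarrow> bool" where
  "smooth_closed_curve c \<longleftrightarrow> smooth_curve c \<and> regular_curve c \<and> (\<exists>T. is_period c T)"

(* The least period exists for every smooth closed curve: such a curve is continuous and,
   being regular, not constant. *)
definition minimal_period :: "(real \<Rightarrow> 'a) \<Rightarrow> real" where
  "minimal_period c = (LEAST T. is_period c T)"

(* df/ds for a function f along c, where s is the arc length of c and both f and c are
   functions of the given parameter t: since ds/dt = |c'(t)|, df/ds = f'(t) / |c'(t)|. *)
definition arc_deriv ::
  "(real \<Rightarrow> 'a::euclidean_space) \<Rightarrow> (real \<Rightarrow> 'a) \<Rightarrow> real \<Rightarrow> 'a" where
  "arc_deriv c f t = curve_deriv f t /\<^sub>R norm (curve_deriv c t)"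

(* The sequence v is indexed from 1.  If v n depends linearly on v 1, ..., v (n - 1), then
   gram_schmidt v n = 0, because sgn 0 = 0. *)
fun gram_schmidt :: "(nat \<Rightarrow> 'a::euclidean_space) \<Rightarrow> nat \<Rightarrow> 'a" where
  "gram_schmidt v n =
     sgn (v n - (\<Sum>j\<in>{1..<n}. (v n \<bullet> gram_schmidt v j) *\<^sub>R gram_schmidt v j))"

declare gram_schmidt.simps [simp del]

definition frenet :: "(real \<Rightarrow> 'a::euclidean_space) \<Rightarrow> nat \<Rightarrow> real \<Rightarrow> 'a" where
  "frenet c i t = gram_schmidt (\<lambda>j. (arc_deriv c ^^ j) c t) i"

(* The i-th curvature (i = 1, 2, 3 is what is used).  If the first i + 1 arc-length
   derivatives are linearly dependent at t, then the frame vector with index i + 1 is 0 at t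
   and so is the i-th curvature; hence k_1, k_2, k_3 can only be non-vanishing where the
   first four derivatives are linearly independent.

   The definition uses nothing but derivatives and inner products.  For a curve contained in
   an affine plane, all derivatives and frame vectors lie in the direction space of the
   plane, so the curvatures of the curve as a curve in that plane, with the induced metric,
   are given by this same formula evaluated in the ambient space. *)
definition curvature :: "(real \<Rightarrow> 'a::euclidean_space) \<Rightarrow> nat \<Rightarrow> real \<Rightarrow> real" where
  "curvature c i t = arc_deriv c (frenet c i) t \<bullet> frenet c (Suc i) t"

(* The integral of f with respect to the arc length of c, as the parameter runs over {0..T}. *)
definition arc_integral ::
  "(real \<Rightarrow> 'a::euclidean_space) \<Rightarrow> real \<Rightarrow> (real \<Rightarrow> real) \<Rightarrow> real" where
  "arc_integral c T f = integral {0..T} (\<lambda>t. f t * norm (curve_deriv c t))"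

(* Pluecker coordinates, in the order 12, 13, 14, 23, 24, 34. *)
definition pluecker :: "real ^ 4 \<Rightarrow> real ^ 4 \<Rightarrow> real ^ 6" where
  "pluecker u v =
     (let p = (\<lambda>i j. u $ i * v $ j - u $ j * v $ i)
      in vector [p 1 2, p 1 3, p 1 4, p 2 3, p 2 4, p 3 4])"

definition osculating_indicatrix :: "(real \<Rightarrow> real ^ 4) \<Rightarrow> real \<Rightarrow> real ^ 6" where
  "osculating_indicatrix x t =
     (let w = pluecker (curve_deriv x t) (curve_deriv (curve_deriv x) t)
      in w /\<^sub>R norm w)"

end

theory Submission imports Defs begin

text \<open>
Along the curve let \<open>e\<^sub>1, \<dots>, e\<^sub>4\<close> be the Frenet frame. The osculating indicatrix is the bivector
\<open>e\<^sub>1 \<and> e\<^sub>2\<close>, and the six bivectors \<open>e\<^sub>i \<and> e\<^sub>j\<close> are an orthonormal basis of \<open>\<real>\<^sup>6\<close>. The Frenet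
equations and the product rule give, in the arc length of the original curve,
\<open>(e\<^sub>1 \<and> e\<^sub>2)' = k\<^sub>2 e\<^sub>1 \<and> e\<^sub>3\<close>, so that the indicatrix is regular with speed \<open>k\<^sub>2\<close> and unit tangent
\<open>e\<^sub>1 \<and> e\<^sub>3\<close>. Write \<open>K\<^sup>2 = k\<^sub>1\<^sup>2 + k\<^sub>2\<^sup>2 + k\<^sub>3\<^sup>2\<close>. Continuing in the same way, one finds the orthonormal frame
\<open>e\<^sub>1 \<and> e\<^sub>3, w, e\<^sub>2 \<and> e\<^sub>4, z\<close> with \<open>K w = k\<^sub>1 e\<^sub>2 \<and> e\<^sub>3 - k\<^sub>2 e\<^sub>1 \<and> e\<^sub>2 + k\<^sub>3 e\<^sub>1 \<and> e\<^sub>4\<close>, and the coefficients of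
the Frenet equations for it are constant:
\<open>K\<close>, \<open>L = 2 k\<^sub>1 k\<^sub>3 / K\<close> and \<open>M = \<surd>(K\<^sup>2 - L\<^sup>2)\<close>, where \<open>L < K\<close> follows from
\<open>K\<^sup>2 - 2 k\<^sub>1 k\<^sub>3 = (k\<^sub>1 - k\<^sub>3)\<^sup>2 + k\<^sub>2\<^sup>2 > 0\<close>. An orthonormal frame that satisfies Frenet equations with
positive coefficients is the Frenet frame (\<open>curvatures_of_frame\<close>), so the curvatures of the
indicatrix are \<open>K / k\<^sub>2\<close>, \<open>L / k\<^sub>2\<close>, \<open>M / k\<^sub>2\<close>.

Both integral formulas are pointwise identities of the integrands: the first curvature times the speed
\<open>k\<^sub>2\<close> is \<open>K\<close>, and the root of the sum of the squared curvatures times \<open>k\<^sub>2\<close> is \<open>\<surd>2 K\<close>, since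
\<open>K\<^sup>2 + L\<^sup>2 + M\<^sup>2 = 2 K\<^sup>2\<close>.
The four-dimensional plane is cut out by two constant vectors: the Frenet matrix regarded as a
bivector, and its Hodge dual (\<open>E12_in_4_plane\<close>).

The Frenet equations themselves are derived for curves in any Euclidean space from the
definition of the frame by Gram-Schmidt: the frame matrix of the derivatives is
skew, because the frame is orthonormal, and has nothing beyond the first superdiagonal, because one
differentiation raises the order of the derivatives involved by one (\<open>arc_deriv_frenet_inner\<close>).
\<close>

section \<open>Smooth functions of one real variable\<close>

lemma curve_deriv_eqI:
  "(f has_vector_derivative D) (at t) \<Longrightarrow> curve_deriv f t = D"
  by (simp add: curve_deriv_def vector_derivative_at)

lemma curve_deriv_works:
  "f differentiable (at t) \<Longrightarrow> (f has_vector_derivative curve_deriv f t) (at t)"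
  by (simp add: curve_deriv_def vector_derivative_works)

text \<open>Smoothness is a statement about all iterated derivatives of one function. A product rule for it needs
an induction in which both factors and their derivatives vary; unfolding the number of derivatives
recursively from the inside gives exactly the right induction hypothesis.\<close>

fun differentiable_times :: "nat \<Rightarrow> (real \<Rightarrow> 'a::euclidean_space) \<Rightarrow> bool" where
  "differentiable_times 0 f \<longleftrightarrow> True"
| "differentiable_times (Suc n) f \<longleftrightarrow>
     (\<forall>t. f differentiable (at t)) \<and> differentiable_times n (curve_deriv f)"

lemma differentiable_times_iff:
  "differentiable_times n f \<longleftrightarrow> (\<forall>k<n. \<forall>t. (curve_deriv ^^ k) f differentiable (at t))"
proof (induction n arbitrary: f)
  case (Suc n)
  show ?case
    unfolding differentiable_times.simps Suc.IH
    by (simp add: All_less_Suc2 funpow_Suc_right del: funpow.simps)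
qed simp

lemma smooth_curve_iff_differentiable_times:
  "smooth_curve f \<longleftrightarrow> (\<forall>n. differentiable_times n f)"
  unfolding smooth_curve_def differentiable_times_iff by blast

lemma differentiable_times_SucD:
  "differentiable_times (Suc n) f \<Longrightarrow> differentiable_times n f"
  by (simp add: differentiable_times_iff)

lemma differentiable_times_SucI:
  assumes "\<And>t. (f has_vector_derivative f' t) (at t)" and "differentiable_times n f'"
  shows "differentiable_times (Suc n) f"
proof -
  have "curve_deriv f = f'"
    using assms(1) by (auto intro: curve_deriv_eqI)
  then show ?thesis
    using assms by (auto intro: differentiableI_vector)
qed

lemma smooth_curve_curve_deriv: "smooth_curve f \<Longrightarrow> smooth_curve (curve_deriv f)"
  unfolding smooth_curve_iff_differentiable_times using differentiable_times.simps(2) by blast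

lemma smooth_curve_differentiable: "smooth_curve f \<Longrightarrow> f differentiable (at t)"
  unfolding smooth_curve_def by (metis funpow_0)

lemma smooth_curve_has_derivative:
  "smooth_curve f \<Longrightarrow> (f has_vector_derivative curve_deriv f t) (at t)"
  by (intro curve_deriv_works smooth_curve_differentiable)

lemma differentiable_times_const: "differentiable_times n (\<lambda>t. c)"
proof (induction n arbitrary: c)
  case (Suc n)
  then show ?case
    by (intro differentiable_times_SucI[where f' = "\<lambda>t. 0"]) auto
qed simp

lemma differentiable_times_add:
  "differentiable_times n f \<Longrightarrow> differentiable_times n g \<Longrightarrow> differentiable_times n (\<lambda>t. f t + g t)"
proof (induction n arbitrary: f g)
  case (Suc n)
  then show ?case
    by (intro differentiable_times_SucI[where f' = "\<lambda>t. curve_deriv f t + curve_deriv g t"]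
          has_vector_derivative_add curve_deriv_works) auto
qed simp

text \<open>The Leibniz rule expresses the derivative of a product as a sum of two products, each of which can
be differentiated one time less. Inner products, scalings and the Pluecker map are all instances.\<close>

lemma differentiable_times_bilinear:
  assumes "bounded_bilinear B"
  shows "differentiable_times n f \<Longrightarrow> differentiable_times n g \<Longrightarrow>
    differentiable_times n (\<lambda>t. B (f t) (g t))"
proof (induction n arbitrary: f g)
  case (Suc n)
  have "differentiable_times n f" "differentiable_times n g"
    using Suc.prems by (auto intro: differentiable_times_SucD simp del: differentiable_times.simps)
  with Suc.prems
  have "differentiable_times n (\<lambda>t. B (f t) (curve_deriv g t) + B (curve_deriv f t) (g t))"
    by (intro differentiable_times_add Suc.IH) auto
  then show ?case
    using Suc.prems
    by (elim differentiable_times_SucI[rotated])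
      (auto intro!: bounded_bilinear.has_vector_derivative[OF assms] curve_deriv_works)
qed simp

text \<open>The exponent is universally quantified because differentiation lowers it. The exponents
\<open>1/2\<close> and \<open>-1/2\<close>, applied to a squared norm, give the speed of a regular curve and its
reciprocal, hence smoothness of arc-length derivatives and of normalized vectors.\<close>

lemma differentiable_times_powr:
  fixes f :: "real \<Rightarrow> real"
  assumes pos: "\<And>t. f t > 0"
  shows "differentiable_times n f \<Longrightarrow> differentiable_times n (\<lambda>t. f t powr p)"
proof (induction n arbitrary: p)
  case (Suc n)
  have "differentiable_times n (\<lambda>t. f t powr (p - 1))"
    by (intro Suc.IH differentiable_times_SucD[OF Suc.prems])
  moreover have "differentiable_times n (curve_deriv f)"
    using Suc.prems by simp
  ultimately have "differentiable_times n (\<lambda>t. p * (f t powr (p - 1) * curve_deriv f t))"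
    by (intro differentiable_times_bilinear[OF bounded_bilinear_mult] differentiable_times_const)
  moreover have "((\<lambda>t. f t powr p) has_vector_derivative p * (f t powr (p - 1) * curve_deriv f t)) (at t)" for t
  proof -
    have "(f has_real_derivative curve_deriv f t) (at t)"
      using Suc.prems curve_deriv_works[of f t]
      by (simp add: has_real_derivative_iff_has_vector_derivative)
    from DERIV_fun_powr[OF this pos, of p] show ?thesis
      by (simp add: has_real_derivative_iff_has_vector_derivative algebra_simps)
  qed
  ultimately show ?case
    by (rule differentiable_times_SucI[rotated])
qed simp

lemma smooth_curve_const: "smooth_curve (\<lambda>t. c)"
  by (simp add: smooth_curve_iff_differentiable_times differentiable_times_const)

lemma smooth_curve_add: "smooth_curve f \<Longrightarrow> smooth_curve g \<Longrightarrow> smooth_curve (\<lambda>t. f t + g t)"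
  by (simp add: smooth_curve_iff_differentiable_times differentiable_times_add)

lemma smooth_curve_bilinear:
  "bounded_bilinear B \<Longrightarrow> smooth_curve f \<Longrightarrow> smooth_curve g \<Longrightarrow> smooth_curve (\<lambda>t. B (f t) (g t))"
  by (simp add: smooth_curve_iff_differentiable_times differentiable_times_bilinear)

lemmas smooth_curve_scaleR = smooth_curve_bilinear[OF bounded_bilinear_scaleR]
lemmas smooth_curve_inner = smooth_curve_bilinear[OF bounded_bilinear_inner]

lemma smooth_curve_powr:
  fixes f :: "real \<Rightarrow> real"
  shows "smooth_curve f \<Longrightarrow> (\<And>t. f t > 0) \<Longrightarrow> smooth_curve (\<lambda>t. f t powr p)"
  by (simp add: smooth_curve_iff_differentiable_times differentiable_times_powr)

lemma smooth_curve_sum: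
  "(\<And>j. j \<in> A \<Longrightarrow> smooth_curve (f j)) \<Longrightarrow> smooth_curve (\<lambda>t. \<Sum>j\<in>A. f j t)"
  by (induction A rule: infinite_finite_induct) (auto intro: smooth_curve_const smooth_curve_add)

lemma smooth_curve_diff:
  assumes "smooth_curve f" "smooth_curve g"
  shows "smooth_curve (\<lambda>t. f t - g t)"
  using smooth_curve_add[OF assms(1) smooth_curve_scaleR[OF smooth_curve_const[of "-1"] assms(2)]]
  by simp

lemma smooth_curve_norm:
  assumes "smooth_curve f" "\<And>t. f t \<noteq> 0"
  shows "smooth_curve (\<lambda>t. norm (f t))"
proof -
  have "norm (f t) = (f t \<bullet> f t) powr (1/2)" for t
    by (simp add: powr_half_sqrt norm_eq_sqrt_inner)
  then show ?thesis
    using smooth_curve_powr[OF smooth_curve_inner[OF assms(1) assms(1)], of "1/2"] assms(2) by simp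
qed

lemma smooth_curve_inverse_norm:
  assumes "smooth_curve f" "\<And>t. f t \<noteq> 0"
  shows "smooth_curve (\<lambda>t. inverse (norm (f t)))"
proof -
  have "inverse (norm (f t)) = (f t \<bullet> f t) powr (-1/2)" for t
    by (simp add: powr_minus powr_half_sqrt norm_eq_sqrt_inner)
  then show ?thesis
    using smooth_curve_powr[OF smooth_curve_inner[OF assms(1) assms(1)], of "-1/2"] assms(2) by simp
qed

lemma smooth_curve_sgn:
  "smooth_curve f \<Longrightarrow> (\<And>t. f t \<noteq> 0) \<Longrightarrow> smooth_curve (\<lambda>t. sgn (f t))"
  unfolding sgn_div_norm by (intro smooth_curve_scaleR smooth_curve_inverse_norm)

lemma smooth_curve_arc_deriv:
  assumes "smooth_curve c" "regular_curve c" "smooth_curve f"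
  shows "smooth_curve (arc_deriv c f)"
  using assms unfolding arc_deriv_def[abs_def] regular_curve_def
  by (intro smooth_curve_scaleR smooth_curve_inverse_norm smooth_curve_curve_deriv) auto

lemma has_arc_deriv:
  assumes "regular_curve c" "smooth_curve f"
  shows "(f has_vector_derivative norm (curve_deriv c t) *\<^sub>R arc_deriv c f t) (at t)"
  using smooth_curve_has_derivative[OF assms(2), of t] assms(1)
  by (simp add: arc_deriv_def regular_curve_def)

lemma arc_deriv_eqI:
  assumes "(f has_vector_derivative norm (curve_deriv c t) *\<^sub>R D) (at t)" "curve_deriv c t \<noteq> 0"
  shows "arc_deriv c f t = D"
  using curve_deriv_eqI[OF assms(1)] assms(2) by (simp add: arc_deriv_def)

section \<open>Gram-Schmidt orthonormalization\<close>

text \<open>A family need not be independent: a dependent vector is sent to 0. The facts below hold in this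
degenerate case too, so that independence enters only as the condition that the vectors produced
are nonzero.\<close>

lemma gram_schmidt_norm_cases:
  "gram_schmidt v n = 0 \<or> norm (gram_schmidt v n) = 1"
  by (subst (1 2) gram_schmidt.simps) (simp add: norm_sgn)

lemma gram_schmidt_orthogonal_less:
  "i < n \<Longrightarrow> 1 \<le> i \<Longrightarrow> gram_schmidt v n \<bullet> gram_schmidt v i = 0"
proof (induction n arbitrary: i rule: less_induct)
  case (less n)
  let ?e = "gram_schmidt v"
  have orth: "?e j \<bullet> ?e i = (if j = i then ?e i \<bullet> ?e i else 0)" if "j \<in> {1..<n}" for j
    using less.IH[of j i] less.IH[of i j] less.prems that
    by (cases j i rule: linorder_cases) (auto simp: inner_commute)
  have "(\<Sum>j\<in>{1..<n}. (v n \<bullet> ?e j) *\<^sub>R ?e j) \<bullet> ?e i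
      = (\<Sum>j\<in>{1..<n}. (v n \<bullet> ?e j) * (if j = i then ?e i \<bullet> ?e i else 0))"
    unfolding inner_sum_left using orth by (intro sum.cong) auto
  also have "\<dots> = (v n \<bullet> ?e i) * (?e i \<bullet> ?e i)"
    using less.prems by (simp add: if_distrib cong: if_cong)
  also have "\<dots> = v n \<bullet> ?e i"
    using gram_schmidt_norm_cases[of v i] by (auto simp: dot_square_norm)
  finally have "(v n - (\<Sum>j\<in>{1..<n}. (v n \<bullet> ?e j) *\<^sub>R ?e j)) \<bullet> ?e i = 0"
    by (simp add: inner_diff_left)
  then show ?case
    by (subst (1) gram_schmidt.simps) (simp add: sgn_div_norm)
qed

lemma gram_schmidt_orthogonal:
  assumes "i \<noteq> j" "1 \<le> i" "1 \<le> j"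
  shows "gram_schmidt v i \<bullet> gram_schmidt v j = 0"
  using assms gram_schmidt_orthogonal_less[of i j v] gram_schmidt_orthogonal_less[of j i v]
  by (metis inner_commute nat_neq_iff)

text \<open>The residual is a multiple of its own normalization, and the factor is its norm.\<close>

lemma gram_schmidt_residual:
  "v n - (\<Sum>j\<in>{1..<n}. (v n \<bullet> gram_schmidt v j) *\<^sub>R gram_schmidt v j)
     = (v n \<bullet> gram_schmidt v n) *\<^sub>R gram_schmidt v n"
  and gram_schmidt_coeff_nonneg: "v n \<bullet> gram_schmidt v n \<ge> 0"
proof -
  let ?e = "gram_schmidt v"
  define r where "r = v n - (\<Sum>j\<in>{1..<n}. (v n \<bullet> ?e j) *\<^sub>R ?e j)"
  have e: "?e n = sgn r"
    unfolding r_def by (rule gram_schmidt.simps)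
  have "(\<Sum>j\<in>{1..<n}. (v n \<bullet> ?e j) *\<^sub>R ?e j) \<bullet> ?e n = 0"
    unfolding inner_sum_left by (intro sum.neutral ballI) (simp add: gram_schmidt_orthogonal)
  then have "v n \<bullet> ?e n = r \<bullet> ?e n"
    by (simp add: r_def inner_diff_left)
  also have "\<dots> = norm r"
    by (cases "r = 0") (simp_all add: e sgn_div_norm dot_square_norm power2_eq_square)
  finally have *: "v n \<bullet> ?e n = norm r" .
  then show "v n \<bullet> ?e n \<ge> 0"
    by simp
  have "r = norm r *\<^sub>R ?e n"
    by (cases "r = 0") (simp_all add: e sgn_div_norm)
  with * show "v n - (\<Sum>j\<in>{1..<n}. (v n \<bullet> ?e j) *\<^sub>R ?e j) = (v n \<bullet> ?e n) *\<^sub>R ?e n"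
    by (simp add: r_def)
qed

text \<open>The coefficients of the original vectors with respect to the orthonormal ones form a triangular
matrix, with positive diagonal where the family is independent.\<close>

lemma gram_schmidt_expand:
  assumes "1 \<le> n"
  shows "v n = (\<Sum>j\<in>{1..n}. (v n \<bullet> gram_schmidt v j) *\<^sub>R gram_schmidt v j)"
proof -
  have "{1..n} = insert n {1..<n}"
    using assms by auto
  then show ?thesis
    using gram_schmidt_residual[of v n] by (simp add: algebra_simps)
qed

lemma gram_schmidt_coeff_pos:
  assumes "gram_schmidt v n \<noteq> 0"
  shows "v n \<bullet> gram_schmidt v n > 0"
proof -
  have "v n \<bullet> gram_schmidt v n \<noteq> 0"
    using assms gram_schmidt_residual[of v n] gram_schmidt.simps[of v n] by auto
  then show ?thesis
    using gram_schmidt_coeff_nonneg[of v n] by simp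
qed

text \<open>Uniqueness of the triangular decomposition: an orthonormal family with respect to which the original
vectors are triangular with positive diagonal is the Gram-Schmidt family.\<close>

lemma gram_schmidt_eqI:
  assumes prev: "\<And>j. j \<in> {1..<n} \<Longrightarrow> gram_schmidt v j = e j"
    and orth: "\<And>i j. i \<in> {1..n} \<Longrightarrow> j \<in> {1..n} \<Longrightarrow> e i \<bullet> e j = (if i = j then 1 else 0)"
    and n: "1 \<le> n"
    and v: "v n = (\<Sum>j\<in>{1..<n}. C j *\<^sub>R e j) + r *\<^sub>R e n" and "r > 0"
  shows "gram_schmidt v n = e n"
proof -
  have C: "v n \<bullet> e j = C j" if "j \<in> {1..<n}" for j
  proof -
    have "v n \<bullet> e j = (\<Sum>i\<in>{1..<n}. C i * (e i \<bullet> e j)) + r * (e n \<bullet> e j)"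
      by (simp add: v inner_add_left inner_sum_left)
    also have "\<dots> = (\<Sum>i\<in>{1..<n}. if i = j then C j else 0) + 0"
      using that orth n by (intro arg_cong2[where f = "(+)"] sum.cong) auto
    finally show ?thesis
      using that by simp
  qed
  have "(\<Sum>j\<in>{1..<n}. (v n \<bullet> gram_schmidt v j) *\<^sub>R gram_schmidt v j) = (\<Sum>j\<in>{1..<n}. C j *\<^sub>R e j)"
    by (intro sum.cong refl) (simp add: prev C)
  then have "gram_schmidt v n = sgn (r *\<^sub>R e n)"
    by (subst gram_schmidt.simps) (simp add: v)
  moreover have "norm (e n) = 1"
    using orth[of n n] n by (simp add: norm_eq_1)
  ultimately show ?thesis
    using \<open>r > 0\<close> by (simp add: sgn_div_norm)
qed

lemma smooth_curve_gram_schmidt: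
  assumes v: "\<And>j. smooth_curve (\<lambda>t. v t j)"
  shows "1 \<le> n \<Longrightarrow> (\<And>j t. j \<in> {1..n} \<Longrightarrow> gram_schmidt (v t) j \<noteq> 0) \<Longrightarrow>
    smooth_curve (\<lambda>t. gram_schmidt (v t) n)"
proof (induction n rule: less_induct)
  case (less n)
  let ?r = "\<lambda>t. v t n - (\<Sum>j\<in>{1..<n}. (v t n \<bullet> gram_schmidt (v t) j) *\<^sub>R gram_schmidt (v t) j)"
  have "smooth_curve (\<lambda>t. gram_schmidt (v t) j)" if "j \<in> {1..<n}" for j
    using that less.prems by (intro less.IH) auto
  then have "smooth_curve ?r"
    by (intro smooth_curve_diff smooth_curve_sum smooth_curve_scaleR smooth_curve_inner v)
  moreover have "?r t \<noteq> 0" for t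
    using less.prems(2)[of n t] less.prems(1) gram_schmidt.simps[of "v t" n] by auto
  ultimately have "smooth_curve (\<lambda>t. sgn (?r t))"
    by (rule smooth_curve_sgn)
  then show ?case
    by (subst gram_schmidt.simps)
qed

section \<open>The Frenet equations\<close>

lemma smooth_curve_arc_deriv_funpow:
  "smooth_curve c \<Longrightarrow> regular_curve c \<Longrightarrow> smooth_curve ((arc_deriv c ^^ j) c)"
  by (induction j) (auto intro: smooth_curve_arc_deriv)

lemma smooth_curve_frenet:
  assumes "smooth_curve c" "regular_curve c" "1 \<le> n" "\<And>j t. j \<in> {1..n} \<Longrightarrow> frenet c j t \<noteq> 0"
  shows "smooth_curve (frenet c n)"
  unfolding frenet_def[abs_def] using assms
  by (intro smooth_curve_gram_schmidt smooth_curve_arc_deriv_funpow) (auto simp: frenet_def)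

lemma frenet_orthogonal:
  "i \<noteq> j \<Longrightarrow> 1 \<le> i \<Longrightarrow> 1 \<le> j \<Longrightarrow> frenet c i t \<bullet> frenet c j t = 0"
  by (simp add: frenet_def gram_schmidt_orthogonal)

lemma frenet_orthonormal:
  assumes "1 \<le> i" "1 \<le> j" "frenet c i t \<noteq> 0"
  shows "frenet c i t \<bullet> frenet c j t = (if i = j then 1 else 0)"
  using assms gram_schmidt_norm_cases[of "\<lambda>j. (arc_deriv c ^^ j) c t" i]
  by (auto simp: frenet_def gram_schmidt_orthogonal norm_eq_1)

text \<open>This is the skew symmetry of the matrix that expresses the derivative of an orthonormal frame in the
frame itself.\<close>

lemma arc_deriv_inner_skew:
  assumes "regular_curve c" "smooth_curve f" "smooth_curve g" and const: "\<And>t. f t \<bullet> g t = k"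
  shows "arc_deriv c f t \<bullet> g t = - (arc_deriv c g t \<bullet> f t)"
proof -
  have "((\<lambda>t. f t \<bullet> g t) has_vector_derivative
      f t \<bullet> (norm (curve_deriv c t) *\<^sub>R arc_deriv c g t) +
      (norm (curve_deriv c t) *\<^sub>R arc_deriv c f t) \<bullet> g t) (at t)"
    by (intro bounded_bilinear.has_vector_derivative[OF bounded_bilinear_inner] has_arc_deriv assms)
  moreover have "((\<lambda>t. f t \<bullet> g t) has_vector_derivative 0) (at t)"
    unfolding const by simp
  ultimately have "norm (curve_deriv c t) * (f t \<bullet> arc_deriv c g t + arc_deriv c f t \<bullet> g t) = 0"
    using vector_derivative_unique_at by (fastforce simp: distrib_left)
  then show ?thesis
    using assms(1) by (simp add: regular_curve_def inner_commute)
qed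

lemma frenet_expand:
  assumes "1 \<le> i"
  shows "(arc_deriv c ^^ i) c t =
    (\<Sum>j\<in>{1..i}. ((arc_deriv c ^^ i) c t \<bullet> frenet c j t) *\<^sub>R frenet c j t)"
  unfolding frenet_def
  using gram_schmidt_expand[OF assms, of "\<lambda>j. (arc_deriv c ^^ j) c t"] .

text \<open>The \<open>i\<close>-th arc-length derivative is a combination of the first \<open>i\<close> frame vectors. Differentiating this
combination and projecting to a later frame vector \<open>e\<^sub>l\<close> removes the terms in which the
coefficients were differentiated, since the first \<open>i\<close> frame vectors are orthogonal to \<open>e\<^sub>l\<close>.\<close>

lemma arc_deriv_inner_frenet:
  assumes c: "smooth_curve c" "regular_curve c" and "1 \<le> i" "i < l"
    and nz: "\<And>j t. j \<in> {1..i} \<Longrightarrow> frenet c j t \<noteq> 0"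
  shows "(arc_deriv c ^^ Suc i) c t \<bullet> frenet c l t =
    (\<Sum>j\<in>{1..i}. ((arc_deriv c ^^ i) c t \<bullet> frenet c j t) * (arc_deriv c (frenet c j) t \<bullet> frenet c l t))"
proof -
  define v where "v = norm (curve_deriv c t)"
  define a where "a = (\<lambda>i. (arc_deriv c ^^ i) c)"
  have v: "v \<noteq> 0"
    using c(2) by (simp add: v_def regular_curve_def)
  have sm: "smooth_curve (a j)" for j
    unfolding a_def by (intro smooth_curve_arc_deriv_funpow c)
  have sme: "smooth_curve (frenet c j)" if "j \<in> {1..i}" for j
    using that by (intro smooth_curve_frenet c nz) auto
  let ?h = "\<lambda>j s. a i s \<bullet> frenet c j s"
  have smh: "smooth_curve (?h j)" if "j \<in> {1..i}" for j
    by (intro smooth_curve_inner sm sme that)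
  have deriv: "((\<lambda>s. \<Sum>j\<in>{1..i}. ?h j s *\<^sub>R frenet c j s) has_vector_derivative
      (\<Sum>j\<in>{1..i}. ?h j t *\<^sub>R (v *\<^sub>R arc_deriv c (frenet c j) t) + curve_deriv (?h j) t *\<^sub>R frenet c j t)) (at t)"
    unfolding v_def
    by (intro has_vector_derivative_sum bounded_bilinear.has_vector_derivative[OF bounded_bilinear_scaleR]
        has_arc_deriv smooth_curve_has_derivative c sme smh)
  have expand: "(\<lambda>s. \<Sum>j\<in>{1..i}. ?h j s *\<^sub>R frenet c j s) = a i"
    unfolding a_def by (rule ext) (rule frenet_expand[OF \<open>1 \<le> i\<close>, symmetric])
  have "(a i has_vector_derivative v *\<^sub>R a (Suc i) t) (at t)"
    using has_arc_deriv[OF c(2) sm[of i], of t] by (simp add: v_def a_def)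
  then have "v *\<^sub>R a (Suc i) t =
      (\<Sum>j\<in>{1..i}. ?h j t *\<^sub>R (v *\<^sub>R arc_deriv c (frenet c j) t) + curve_deriv (?h j) t *\<^sub>R frenet c j t)"
    by (rule vector_derivative_unique_at) (rule deriv[unfolded expand])
  then have "(v *\<^sub>R a (Suc i) t) \<bullet> frenet c l t =
      (\<Sum>j\<in>{1..i}. ?h j t *\<^sub>R (v *\<^sub>R arc_deriv c (frenet c j) t) + curve_deriv (?h j) t *\<^sub>R frenet c j t)
       \<bullet> frenet c l t"
    by simp
  also have "\<dots> = (\<Sum>j\<in>{1..i}. v * (?h j t * (arc_deriv c (frenet c j) t \<bullet> frenet c l t)))"
    unfolding inner_sum_left using nz \<open>i < l\<close>
    by (intro sum.cong) (auto simp: inner_add_left frenet_orthonormal)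
  finally show ?thesis
    using v by (simp add: a_def flip: sum_distrib_left)
qed

text \<open>The left-hand side of the preceding identity vanishes for \<open>l \<ge> i + 2\<close>, because the derivative of order
\<open>i + 1\<close> lies in the span of the first \<open>i + 1\<close> frame vectors. By induction all terms on the right
except the last vanish, and the coefficient of the last one is positive.\<close>

lemma arc_deriv_frenet_orthogonal:
  assumes c: "smooth_curve c" "regular_curve c"
  shows "1 \<le> i \<Longrightarrow> Suc i < l \<Longrightarrow> (\<And>j t. j \<in> {1..i} \<Longrightarrow> frenet c j t \<noteq> 0) \<Longrightarrow>
    arc_deriv c (frenet c i) t \<bullet> frenet c l t = 0"
proof (induction i rule: less_induct)
  case (less i)
  let ?a = "\<lambda>i. (arc_deriv c ^^ i) c"
  have *: "{1..i} = insert i {1..<i}"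
    using less.prems by auto
  have Suc_i: "1 \<le> Suc i"
    by simp
  have "?a (Suc i) t \<bullet> frenet c l t = 0"
    by (subst frenet_expand[OF Suc_i], unfold inner_sum_left, intro sum.neutral)
      (use less.prems in \<open>auto simp: frenet_orthogonal\<close>)
  moreover have "?a (Suc i) t \<bullet> frenet c l t =
      (\<Sum>j\<in>{1..i}. (?a i t \<bullet> frenet c j t) * (arc_deriv c (frenet c j) t \<bullet> frenet c l t))"
    using less.prems by (intro arc_deriv_inner_frenet c) auto
  moreover have "arc_deriv c (frenet c j) t \<bullet> frenet c l t = 0" if "j \<in> {1..<i}" for j
    using that less.prems by (intro less.IH) auto
  ultimately have "(?a i t \<bullet> frenet c i t) * (arc_deriv c (frenet c i) t \<bullet> frenet c l t) = 0"
    unfolding * by simp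
  moreover have "?a i t \<bullet> frenet c i t > 0"
    using less.prems gram_schmidt_coeff_pos[of "\<lambda>j. ?a j t" i] by (auto simp: frenet_def)
  ultimately show ?case
    by simp
qed

text \<open>For \<open>l = i + 1\<close> the same identity reduces to
\<open>\<langle>c\<^sup>(\<^sup>i\<^sup>+\<^sup>1\<^sup>), e\<^sub>i\<^sub>+\<^sub>1\<rangle> = \<langle>c\<^sup>(\<^sup>i\<^sup>), e\<^sub>i\<rangle> k\<^sub>i\<close>, and both inner products are diagonal
coefficients of the triangular matrix.\<close>

lemma curvature_pos:
  assumes c: "smooth_curve c" "regular_curve c" and "1 \<le> i"
    and nz: "\<And>j t. j \<in> {1..Suc i} \<Longrightarrow> frenet c j t \<noteq> 0"
  shows "curvature c i t > 0"
proof -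
  let ?a = "\<lambda>i. (arc_deriv c ^^ i) c"
  have *: "{1..i} = insert i {1..<i}"
    using \<open>1 \<le> i\<close> by auto
  have far: "arc_deriv c (frenet c j) t \<bullet> frenet c (Suc i) t = 0" if "j \<in> {1..<i}" for j
    using that nz by (intro arc_deriv_frenet_orthogonal c) auto
  have "?a (Suc i) t \<bullet> frenet c (Suc i) t =
      (\<Sum>j\<in>{1..i}. (?a i t \<bullet> frenet c j t) * (arc_deriv c (frenet c j) t \<bullet> frenet c (Suc i) t))"
    using assms by (intro arc_deriv_inner_frenet) auto
  also have "\<dots> = (?a i t \<bullet> frenet c i t) * curvature c i t"
    unfolding * using far by (simp add: curvature_def)
  finally have "(?a i t \<bullet> frenet c i t) * curvature c i t > 0"
    using gram_schmidt_coeff_pos[of "\<lambda>j. ?a j t" "Suc i"] nz[of "Suc i" t] by (simp add: frenet_def)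
  moreover have "?a i t \<bullet> frenet c i t > 0"
    using gram_schmidt_coeff_pos[of "\<lambda>j. ?a j t" i] nz[of i t] \<open>1 \<le> i\<close> by (simp add: frenet_def)
  ultimately show ?thesis
    by (simp add: zero_less_mult_iff)
qed

text \<open>The Frenet matrix is skew and has no entry beyond the first superdiagonal, hence is tridiagonal.\<close>

lemma arc_deriv_frenet_inner:
  assumes c: "smooth_curve c" "regular_curve c" and ij: "i \<in> {1..n}" "j \<in> {1..n}"
    and nz: "\<And>j t. j \<in> {1..n} \<Longrightarrow> frenet c j t \<noteq> 0"
  shows "arc_deriv c (frenet c i) t \<bullet> frenet c j t =
    (if j = Suc i then curvature c i t else if i = Suc j then - curvature c j t else 0)"
proof -
  have sme: "smooth_curve (frenet c j)" if "j \<in> {1..n}" for j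
    using that by (intro smooth_curve_frenet c nz) auto
  have skew: "arc_deriv c (frenet c i) t \<bullet> frenet c j t = - (arc_deriv c (frenet c j) t \<bullet> frenet c i t)"
    using ij nz by (intro arc_deriv_inner_skew[where k = "if i = j then 1 else 0"] c sme)
      (auto simp: frenet_orthonormal)
  have far: "arc_deriv c (frenet c p) t \<bullet> frenet c q t = 0" if "p \<in> {1..n}" "Suc p < q" for p q
    using that by (intro arc_deriv_frenet_orthogonal c nz) auto
  consider "i = j" | "j = Suc i" | "i = Suc j" | "Suc i < j" | "Suc j < i"
    by linarith
  then show ?thesis
  proof cases
    assume "i = j"
    then show ?thesis
      using skew by simp
  next
    assume "j = Suc i"
    then show ?thesis
      by (simp add: curvature_def)
  next
    assume "i = Suc j"
    then show ?thesis
      by (subst skew) (simp add: curvature_def)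
  next
    assume "Suc i < j"
    then show ?thesis
      using far[OF ij(1)] by simp
  next
    assume "Suc j < i"
    then show ?thesis
      by (subst skew) (use far[OF ij(2)] in simp)
  qed
qed

lemma orthonormal_family_expand:
  fixes e :: "'i \<Rightarrow> 'a::euclidean_space"
  assumes orth: "\<And>i j. i \<in> I \<Longrightarrow> j \<in> I \<Longrightarrow> e i \<bullet> e j = (if i = j then 1 else 0)"
    and I: "finite I" "card I = DIM('a)"
  shows "x = (\<Sum>i\<in>I. (x \<bullet> e i) *\<^sub>R e i)"
proof -
  have inj: "inj_on e I"
    using orth by (metis inj_onI zero_neq_one)
  have nrm: "norm b = 1" if "b \<in> e ` I" for b
    using that orth by (auto simp: norm_eq_1)
  have pw: "pairwise orthogonal (e ` I)"
    using orth by (auto simp: pairwise_def orthogonal_def)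
  have "independent (e ` I)"
    using pw nrm by (intro pairwise_orthogonal_independent) fastforce+
  then have "span (e ` I) = UNIV"
    using inj I by (metis card_image dim_eq_full dim_eq_card_independent)
  then have "(\<Sum>b\<in>e ` I. (x \<bullet> b) *\<^sub>R b) = x"
    using pw nrm I by (intro orthonormal_basis_expand) auto
  then show ?thesis
    by (simp add: sum.reindex[OF inj])
qed

lemma sum_1_4: "(\<Sum>j\<in>{1..4::nat}. f j) = f 1 + f 2 + f 3 + (f 4 :: 'a::comm_monoid_add)"
proof -
  have "{1..4::nat} = {1, 2, 3, 4}"
    by auto
  then show ?thesis
    by (simp add: add.assoc)
qed

text \<open>In dimension 4 the four frame vectors form a basis, so the derivatives are determined by their inner
products with the frame; in particular the last equation has no further term.\<close>

lemma frenet_equations_4: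
  fixes c :: "real \<Rightarrow> 'a::euclidean_space"
  assumes dim: "DIM('a) = 4" and c: "smooth_curve c" "regular_curve c"
    and nz: "\<And>j t. j \<in> {1..4} \<Longrightarrow> frenet c j t \<noteq> 0"
  shows "arc_deriv c (frenet c 1) t = curvature c 1 t *\<^sub>R frenet c 2 t"
    and "arc_deriv c (frenet c 2) t = curvature c 2 t *\<^sub>R frenet c 3 t - curvature c 1 t *\<^sub>R frenet c 1 t"
    and "arc_deriv c (frenet c 3) t = curvature c 3 t *\<^sub>R frenet c 4 t - curvature c 2 t *\<^sub>R frenet c 2 t"
    and "arc_deriv c (frenet c 4) t = - curvature c 3 t *\<^sub>R frenet c 3 t"
proof -
  have exp: "x = (\<Sum>j\<in>{1..4}. (x \<bullet> frenet c j t) *\<^sub>R frenet c j t)" for x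
    using nz by (intro orthonormal_family_expand) (auto simp: frenet_orthonormal dim)
  have *: "arc_deriv c (frenet c i) t = (\<Sum>j\<in>{1..4}. (if j = Suc i then curvature c i t
      else if i = Suc j then - curvature c j t else 0) *\<^sub>R frenet c j t)" if "i \<in> {1..4}" for i
    by (subst exp) (intro sum.cong refl, simp only: arc_deriv_frenet_inner[OF c that _ nz])
  show "arc_deriv c (frenet c 1) t = curvature c 1 t *\<^sub>R frenet c 2 t"
    and "arc_deriv c (frenet c 2) t = curvature c 2 t *\<^sub>R frenet c 3 t - curvature c 1 t *\<^sub>R frenet c 1 t"
    and "arc_deriv c (frenet c 3) t = curvature c 3 t *\<^sub>R frenet c 4 t - curvature c 2 t *\<^sub>R frenet c 2 t"
    and "arc_deriv c (frenet c 4) t = - curvature c 3 t *\<^sub>R frenet c 3 t"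
    using *[of 1] *[of 2] *[of 3] *[of 4] unfolding sum_1_4 by simp_all
qed

text \<open>Converse of the Frenet equations, for constant positive curvatures: an orthonormal frame which
satisfies them is the Frenet frame, because they make the first four arc-length derivatives
triangular with diagonal \<open>1, \<kappa>\<^sub>1, \<kappa>\<^sub>1 \<kappa>\<^sub>2, \<kappa>\<^sub>1 \<kappa>\<^sub>2 \<kappa>\<^sub>3\<close>.\<close>

lemma curvatures_of_frame:
  fixes c :: "real \<Rightarrow> 'a::euclidean_space" and f :: "nat \<Rightarrow> real \<Rightarrow> 'a"
  assumes reg: "regular_curve c"
    and orth: "\<And>i j t. i \<in> {1..4} \<Longrightarrow> j \<in> {1..4} \<Longrightarrow> f i t \<bullet> f j t = (if i = j then 1 else 0)"
    and pos: "\<kappa>\<^sub>1 > 0" "\<kappa>\<^sub>2 > 0" "\<kappa>\<^sub>3 > 0"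
    and d: "\<And>t. (c has_vector_derivative norm (curve_deriv c t) *\<^sub>R f 1 t) (at t)"
      "\<And>t. (f 1 has_vector_derivative norm (curve_deriv c t) *\<^sub>R (\<kappa>\<^sub>1 *\<^sub>R f 2 t)) (at t)"
      "\<And>t. (f 2 has_vector_derivative norm (curve_deriv c t) *\<^sub>R (\<kappa>\<^sub>2 *\<^sub>R f 3 t - \<kappa>\<^sub>1 *\<^sub>R f 1 t)) (at t)"
      "\<And>t. (f 3 has_vector_derivative norm (curve_deriv c t) *\<^sub>R (\<kappa>\<^sub>3 *\<^sub>R f 4 t - \<kappa>\<^sub>2 *\<^sub>R f 2 t)) (at t)"
  shows "curvature c 1 t = \<kappa>\<^sub>1" "curvature c 2 t = \<kappa>\<^sub>2" "curvature c 3 t = \<kappa>\<^sub>3"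
proof -
  have D: "arc_deriv c g = h" if "\<And>t. (g has_vector_derivative norm (curve_deriv c t) *\<^sub>R h t) (at t)" for g h
    using that reg by (auto intro: arc_deriv_eqI simp: regular_curve_def)
  have D1: "arc_deriv c (f 1) = (\<lambda>t. \<kappa>\<^sub>1 *\<^sub>R f 2 t)"
    and D2: "arc_deriv c (f 2) = (\<lambda>t. \<kappa>\<^sub>2 *\<^sub>R f 3 t - \<kappa>\<^sub>1 *\<^sub>R f 1 t)"
    and D3: "arc_deriv c (f 3) = (\<lambda>t. \<kappa>\<^sub>3 *\<^sub>R f 4 t - \<kappa>\<^sub>2 *\<^sub>R f 2 t)"
    by (intro D d)+
  define a where "a = (\<lambda>j. (arc_deriv c ^^ j) c)"
  have "a (Suc j) = arc_deriv c (a j)" for j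
    by (simp add: a_def)
  from this[of 1] this[of 2] this[of 3]
  have aS: "a 2 = arc_deriv c (a 1)" "a 3 = arc_deriv c (a 2)" "a 4 = arc_deriv c (a 3)"
    by (simp_all only: Suc_1 Suc_numeral semiring_norm)
  have a1: "a 1 = f 1"
    using D[OF d(1)] by (simp add: a_def)
  have a2: "a 2 = (\<lambda>t. \<kappa>\<^sub>1 *\<^sub>R f 2 t)"
    unfolding aS(1) a1 D1 ..
  note cd = bounded_linear.has_vector_derivative[OF bounded_linear_scaleR_right]
  have a3: "a 3 = (\<lambda>t. (\<kappa>\<^sub>1 * \<kappa>\<^sub>2) *\<^sub>R f 3 t - (\<kappa>\<^sub>1 * \<kappa>\<^sub>1) *\<^sub>R f 1 t)"
  proof -
    have "a 3 = arc_deriv c (\<lambda>t. \<kappa>\<^sub>1 *\<^sub>R f 2 t)"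
      unfolding aS(2) a2 ..
    also have "\<dots> = (\<lambda>t. (\<kappa>\<^sub>1 * \<kappa>\<^sub>2) *\<^sub>R f 3 t - (\<kappa>\<^sub>1 * \<kappa>\<^sub>1) *\<^sub>R f 1 t)"
      by (intro D has_vector_derivative_eq_rhs[OF cd[OF d(3)]]) (simp add: algebra_simps)
    finally show ?thesis .
  qed
  have a4: "a 4 = (\<lambda>t. (\<kappa>\<^sub>1 * \<kappa>\<^sub>2 * \<kappa>\<^sub>3) *\<^sub>R f 4 t - (\<kappa>\<^sub>1 * \<kappa>\<^sub>2 * \<kappa>\<^sub>2 + \<kappa>\<^sub>1 * \<kappa>\<^sub>1 * \<kappa>\<^sub>1) *\<^sub>R f 2 t)"
  proof -
    have "a 4 = arc_deriv c (a 3)"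
      by (rule aS)
    also have "\<dots> = (\<lambda>t. (\<kappa>\<^sub>1 * \<kappa>\<^sub>2 * \<kappa>\<^sub>3) *\<^sub>R f 4 t - (\<kappa>\<^sub>1 * \<kappa>\<^sub>2 * \<kappa>\<^sub>2 + \<kappa>\<^sub>1 * \<kappa>\<^sub>1 * \<kappa>\<^sub>1) *\<^sub>R f 2 t)"
      unfolding a3
      by (intro D has_vector_derivative_eq_rhs[OF has_vector_derivative_diff[OF cd[OF d(4)] cd[OF d(2)]]])
        (simp add: algebra_simps)
    finally show ?thesis .
  qed
  have fr: "frenet c j t = gram_schmidt (\<lambda>j. a j t) j" for j t
    by (simp add: frenet_def a_def)
  have sets: "{1..<2::nat} = {1}" "{1..<3::nat} = {1, 2}" "{1..<4::nat} = {1, 2, 3}"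
    by auto
  have f1: "frenet c 1 t = f 1 t" for t
    unfolding fr by (rule gram_schmidt_eqI[where C = "\<lambda>_. 0" and r = 1 and e = "\<lambda>j. f j t"])
      (use orth in \<open>auto simp: a1[simplified]\<close>)
  have f2: "frenet c 2 t = f 2 t" for t
    unfolding fr by (rule gram_schmidt_eqI[where C = "\<lambda>_. 0" and r = "\<kappa>\<^sub>1" and e = "\<lambda>j. f j t"])
      (unfold sets, use orth f1 pos in \<open>auto simp: a2 fr\<close>)
  have f3: "frenet c 3 t = f 3 t" for t
    unfolding fr by (rule gram_schmidt_eqI[where C = "\<lambda>j. if j = 1 then - (\<kappa>\<^sub>1 * \<kappa>\<^sub>1) else 0"
          and r = "\<kappa>\<^sub>1 * \<kappa>\<^sub>2" and e = "\<lambda>j. f j t"])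
      (unfold sets, use orth f1 f2 pos in \<open>auto simp: a3 fr\<close>)
  have f4: "frenet c 4 t = f 4 t" for t
    unfolding fr by (rule gram_schmidt_eqI[where
          C = "\<lambda>j. if j = 2 then - (\<kappa>\<^sub>1 * \<kappa>\<^sub>2 * \<kappa>\<^sub>2 + \<kappa>\<^sub>1 * \<kappa>\<^sub>1 * \<kappa>\<^sub>1) else 0"
          and r = "\<kappa>\<^sub>1 * \<kappa>\<^sub>2 * \<kappa>\<^sub>3" and e = "\<lambda>j. f j t"])
      (unfold sets, use orth f1 f2 f3 pos in \<open>auto simp: a4 fr simp flip: scaleR_minus_left\<close>)
  have eqs: "frenet c 1 = f 1" "frenet c 2 = f 2" "frenet c 3 = f 3" "frenet c 4 = f 4"
    using f1 f2 f3 f4 by auto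
  have S: "Suc 1 = 2" "Suc 2 = 3" "Suc 3 = 4"
    by simp_all
  show "curvature c 1 t = \<kappa>\<^sub>1" "curvature c 2 t = \<kappa>\<^sub>2" "curvature c 3 t = \<kappa>\<^sub>3"
    unfolding curvature_def S eqs D1 D2 D3 by (simp_all add: inner_diff_left orth)
qed

section \<open>Pluecker coordinates and affine planes\<close>

lemma exhaust_6:
  fixes x :: 6
  shows "x = 1 \<or> x = 2 \<or> x = 3 \<or> x = 4 \<or> x = 5 \<or> x = 6"
proof (induct x)
  case (of_int z)
  then have "z = 0 \<or> z = 1 \<or> z = 2 \<or> z = 3 \<or> z = 4 \<or> z = 5" by fastforce
  then show ?case by auto
qed

lemma UNIV_6: "UNIV = {1, 2, 3, 4, 5, 6 :: 6}"
  using exhaust_6 by auto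

lemma forall_6: "(\<forall>i::6. P i) \<longleftrightarrow> P 1 \<and> P 2 \<and> P 3 \<and> P 4 \<and> P 5 \<and> P 6"
  by (metis exhaust_6)

lemma sum_6: "sum f (UNIV :: 6 set) = f 1 + f 2 + f 3 + f 4 + f 5 + f 6"
  unfolding UNIV_6 by (simp add: ac_simps)

lemma vector_6:
  "(vector [a, b, c, d, e, f] :: ('a::zero)^6) $ 1 = a"
  "(vector [a, b, c, d, e, f] :: ('a::zero)^6) $ 2 = b"
  "(vector [a, b, c, d, e, f] :: ('a::zero)^6) $ 3 = c"
  "(vector [a, b, c, d, e, f] :: ('a::zero)^6) $ 4 = d"
  "(vector [a, b, c, d, e, f] :: ('a::zero)^6) $ 5 = e"
  "(vector [a, b, c, d, e, f] :: ('a::zero)^6) $ 6 = f"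
  unfolding vector_def by simp_all

lemma pluecker_nth:
  "pluecker u v $ 1 = u $ 1 * v $ 2 - u $ 2 * v $ 1"
  "pluecker u v $ 2 = u $ 1 * v $ 3 - u $ 3 * v $ 1"
  "pluecker u v $ 3 = u $ 1 * v $ 4 - u $ 4 * v $ 1"
  "pluecker u v $ 4 = u $ 2 * v $ 3 - u $ 3 * v $ 2"
  "pluecker u v $ 5 = u $ 2 * v $ 4 - u $ 4 * v $ 2"
  "pluecker u v $ 6 = u $ 3 * v $ 4 - u $ 4 * v $ 3"
  by (simp_all add: pluecker_def vector_6 Let_def)

lemma bounded_bilinear_pluecker: "bounded_bilinear pluecker"
  unfolding bilinear_conv_bounded_bilinear[symmetric] bilinear_def linear_iff
  by (simp add: vec_eq_iff forall_6 pluecker_nth algebra_simps)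

text \<open>The Pluecker vectors are bivectors with their usual inner product, the Gram determinant
(identity of Lagrange). Hence an orthonormal basis of \<open>\<real>\<^sup>4\<close> induces one of \<open>\<real>\<^sup>6\<close>.\<close>

lemma pluecker_inner:
  "pluecker a b \<bullet> pluecker c d = (a \<bullet> c) * (b \<bullet> d) - (a \<bullet> d) * (b \<bullet> c)"
  by (simp add: inner_vec_def sum_6 sum_4 pluecker_nth algebra_simps)

lemma pluecker_self: "pluecker u u = 0"
  by (simp add: vec_eq_iff forall_6 pluecker_nth)

text \<open>The strict Cauchy-Schwarz inequality says that the two normal vectors are independent.\<close>

lemma aff_dim_Int_two_hyperplanes:
  fixes a b :: "'a::euclidean_space"
  assumes "(a \<bullet> b)\<^sup>2 < (a \<bullet> a) * (b \<bullet> b)" and x: "a \<bullet> x = p" "b \<bullet> x = q"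
  shows "aff_dim ({x. a \<bullet> x = p} \<inter> {x. b \<bullet> x = q}) = int DIM('a) - 2"
proof -
  have a: "a \<noteq> 0"
    using assms by auto
  define z where "z = (a \<bullet> a) *\<^sub>R b - (a \<bullet> b) *\<^sub>R a"
  have "a \<bullet> z = 0" "b \<bullet> z \<noteq> 0"
    using assms(1) by (auto simp: z_def inner_diff_right power2_eq_square inner_commute mult.commute)
  then have "x + z \<in> {x. a \<bullet> x = p} - {x. b \<bullet> x = q}"
    using x by (simp add: inner_add_right)
  moreover have "x \<in> {x. a \<bullet> x = p} \<inter> {x. b \<bullet> x = q}"
    using x by simp
  ultimately have "aff_dim ({x. a \<bullet> x = p} \<inter> {x. b \<bullet> x = q}) = aff_dim {x. a \<bullet> x = p} - 1"
    by (subst aff_dim_affine_Int_hyperplane) (auto simp: affine_hyperplane)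
  then show ?thesis
    using aff_dim_hyperplane[OF a] by simp
qed

section \<open>The osculating bivector of a curve with constant curvatures\<close>

text \<open>The moving frame of a curve with speed \<open>v\<close> and constant curvatures. The equations are those in the arc
length multiplied by \<open>v\<close>, because the frame is a function of the original parameter.\<close>

locale constant_curvature_frame =
  fixes v :: "real \<Rightarrow> real" and e :: "nat \<Rightarrow> real \<Rightarrow> real ^ 4" and k1 k2 k3 :: real
  assumes v_pos: "v t > 0"
    and k_pos: "k1 > 0" "k2 > 0" "k3 > 0"
    and orth: "i \<in> {1..4} \<Longrightarrow> j \<in> {1..4} \<Longrightarrow> e i t \<bullet> e j t = (if i = j then 1 else 0)"
    and de: "(e 1 has_vector_derivative v t *\<^sub>R (k1 *\<^sub>R e 2 t)) (at t)"
      "(e 2 has_vector_derivative v t *\<^sub>R (k2 *\<^sub>R e 3 t - k1 *\<^sub>R e 1 t)) (at t)"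
      "(e 3 has_vector_derivative v t *\<^sub>R (k3 *\<^sub>R e 4 t - k2 *\<^sub>R e 2 t)) (at t)"
      "(e 4 has_vector_derivative v t *\<^sub>R (- k3 *\<^sub>R e 3 t)) (at t)"
begin

text \<open>Denoted \<open>e\<^sub>i \<and> e\<^sub>j\<close> in the explanations.\<close>

definition E :: "nat \<Rightarrow> nat \<Rightarrow> real \<Rightarrow> real ^ 6" where
  "E i j t = pluecker (e i t) (e j t)"

lemma E_inner:
  assumes "i \<in> {1..4}" "j \<in> {1..4}" "i' \<in> {1..4}" "j' \<in> {1..4}"
  shows "E i j t \<bullet> E i' j' t = (if i = i' \<and> j = j' then 1 else 0) - (if i = j' \<and> j = i' then 1 else 0)"
proof -
  have *: "(if P then 1 else 0) * (if Q then 1 else 0) = (if P \<and> Q then 1 else (0::real))" for P Q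
    by simp
  show ?thesis
    unfolding E_def pluecker_inner orth[OF assms(1,3)] orth[OF assms(1,4)] orth[OF assms(2,3)] orth[OF assms(2,4)] *
    ..
qed

lemma E_derivative:
  "(E 1 2 has_vector_derivative v t *\<^sub>R (k2 *\<^sub>R E 1 3 t)) (at t)"
  "(E 1 3 has_vector_derivative v t *\<^sub>R (k1 *\<^sub>R E 2 3 t - k2 *\<^sub>R E 1 2 t + k3 *\<^sub>R E 1 4 t)) (at t)"
  "(E 1 4 has_vector_derivative v t *\<^sub>R (k1 *\<^sub>R E 2 4 t - k3 *\<^sub>R E 1 3 t)) (at t)"
  "(E 2 3 has_vector_derivative v t *\<^sub>R (k3 *\<^sub>R E 2 4 t - k1 *\<^sub>R E 1 3 t)) (at t)"
  "(E 2 4 has_vector_derivative v t *\<^sub>R (k2 *\<^sub>R E 3 4 t - k1 *\<^sub>R E 1 4 t - k3 *\<^sub>R E 2 3 t)) (at t)"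
  "(E 3 4 has_vector_derivative v t *\<^sub>R (- k2 *\<^sub>R E 2 4 t)) (at t)"
proof -
  interpret pluecker: bounded_bilinear pluecker
    by (rule bounded_bilinear_pluecker)
  note dp = has_vector_derivative_eq_rhs[OF pluecker.has_vector_derivative]
  note simps = pluecker.scaleR_left pluecker.scaleR_right pluecker.diff_left pluecker.diff_right
    pluecker.minus_left pluecker.minus_right pluecker_self algebra_simps
  show "(E 1 2 has_vector_derivative v t *\<^sub>R (k2 *\<^sub>R E 1 3 t)) (at t)"
    unfolding E_def[abs_def] by (rule dp[OF de(1) de(2)]) (simp add: simps)
  show "(E 1 3 has_vector_derivative v t *\<^sub>R (k1 *\<^sub>R E 2 3 t - k2 *\<^sub>R E 1 2 t + k3 *\<^sub>R E 1 4 t)) (at t)"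
    unfolding E_def[abs_def] by (rule dp[OF de(1) de(3)]) (simp add: simps)
  show "(E 1 4 has_vector_derivative v t *\<^sub>R (k1 *\<^sub>R E 2 4 t - k3 *\<^sub>R E 1 3 t)) (at t)"
    unfolding E_def[abs_def] by (rule dp[OF de(1) de(4)]) (simp add: simps)
  show "(E 2 3 has_vector_derivative v t *\<^sub>R (k3 *\<^sub>R E 2 4 t - k1 *\<^sub>R E 1 3 t)) (at t)"
    unfolding E_def[abs_def] by (rule dp[OF de(2) de(3)]) (simp add: simps)
  show "(E 2 4 has_vector_derivative v t *\<^sub>R (k2 *\<^sub>R E 3 4 t - k1 *\<^sub>R E 1 4 t - k3 *\<^sub>R E 2 3 t)) (at t)"
    unfolding E_def[abs_def] by (rule dp[OF de(2) de(4)]) (simp add: simps)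
  show "(E 3 4 has_vector_derivative v t *\<^sub>R (- k2 *\<^sub>R E 2 4 t)) (at t)"
    unfolding E_def[abs_def] by (rule dp[OF de(3) de(4)]) (simp add: simps)
qed

lemmas has_derivative_scaled = bounded_linear.has_vector_derivative[OF bounded_linear_scaleR_right]

text \<open>The bivector \<open>k\<^sub>1 e\<^sub>1 \<and> e\<^sub>2 + k\<^sub>2 e\<^sub>2 \<and> e\<^sub>3 + k\<^sub>3 e\<^sub>3 \<and> e\<^sub>4\<close> and its Hodge dual have squared norm
\<open>k\<^sub>1\<^sup>2 + k\<^sub>2\<^sup>2 + k\<^sub>3\<^sup>2\<close> and inner product \<open>2 k\<^sub>1 k\<^sub>3\<close>. The inequality makes them independent, and it
also keeps the third curvature of the indicatrix away from 0.\<close>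

lemma dual_gap: "2 * k1 * k3 < k1\<^sup>2 + k2\<^sup>2 + k3\<^sup>2"
proof -
  have "(k1 - k3)\<^sup>2 + k2\<^sup>2 > 0"
    using k_pos by (simp add: add_nonneg_pos)
  then show ?thesis
    by (simp add: power2_eq_square algebra_simps)
qed

text \<open>The Frenet matrix, read as a bivector \<open>n\<close>, generates the rotation of the frame. It commutes with
itself, so \<open>n\<close> is a constant vector of \<open>\<real>\<^sup>6\<close>; and so is its Hodge dual \<open>m\<close>. Both have constant
coefficients in the moving basis, hence constant inner products with \<open>e\<^sub>1 \<and> e\<^sub>2\<close>. This confines the
indicatrix to the intersection of two hyperplanes that are not parallel.\<close>

lemma E12_in_4_plane: "\<exists>P. affine P \<and> aff_dim P = 4 \<and> range (E 1 2) \<subseteq> P"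
proof -
  define n where "n = (\<lambda>t. k1 *\<^sub>R E 1 2 t + k2 *\<^sub>R E 2 3 t + k3 *\<^sub>R E 3 4 t)"
  \<comment> \<open>the dual of \<open>n\<close>: the index pairs 12, 23, 34 become 34, 14, 12\<close>
  define m where "m = (\<lambda>t. k3 *\<^sub>R E 1 2 t + k2 *\<^sub>R E 1 4 t + k1 *\<^sub>R E 3 4 t)"
  have "(n has_vector_derivative 0) (at t)" for t
    unfolding n_def
    by (rule has_vector_derivative_eq_rhs[OF has_vector_derivative_add[OF has_vector_derivative_add
            [OF has_derivative_scaled[OF E_derivative(1)] has_derivative_scaled[OF E_derivative(4)]] has_derivative_scaled[OF E_derivative(6)]]]) (simp add: algebra_simps)
  then have n: "n t = n 0" for t
    by (metis UNIV_I convex_UNIV has_vector_derivative_zero_constant)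
  have "(m has_vector_derivative 0) (at t)" for t
    unfolding m_def
    by (rule has_vector_derivative_eq_rhs[OF has_vector_derivative_add[OF has_vector_derivative_add
            [OF has_derivative_scaled[OF E_derivative(1)] has_derivative_scaled[OF E_derivative(3)]] has_derivative_scaled[OF E_derivative(6)]]]) (simp add: algebra_simps)
  then have m: "m t = m 0" for t
    by (metis UNIV_I convex_UNIV has_vector_derivative_zero_constant)
  have nE: "n 0 \<bullet> E 1 2 t = k1" and mE: "m 0 \<bullet> E 1 2 t = k3" for t
    unfolding n[of t, symmetric] m[of t, symmetric] unfolding n_def m_def
    by (simp_all add: inner_add_left E_inner)
  have nn: "n 0 \<bullet> n 0 = k1\<^sup>2 + k2\<^sup>2 + k3\<^sup>2" and mm: "m 0 \<bullet> m 0 = k1\<^sup>2 + k2\<^sup>2 + k3\<^sup>2"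
    and nm: "n 0 \<bullet> m 0 = 2 * k1 * k3"
    unfolding n_def m_def by (simp_all add: inner_add_left inner_add_right E_inner power2_eq_square)
  have "(n 0 \<bullet> m 0)\<^sup>2 < (n 0 \<bullet> n 0) * (m 0 \<bullet> m 0)"
    unfolding nn mm nm using dual_gap k_pos
    by (simp only: power2_eq_square[of "k1\<^sup>2 + k2\<^sup>2 + k3\<^sup>2", symmetric]) (intro power_strict_mono, auto)
  from aff_dim_Int_two_hyperplanes[OF this nE[of 0] mE[of 0]]
  have "aff_dim ({x. n 0 \<bullet> x = k1} \<inter> {x. m 0 \<bullet> x = k3}) = 4"
    by simp
  moreover have "affine ({x. n 0 \<bullet> x = k1} \<inter> {x. m 0 \<bullet> x = k3})"
    by (intro affine_Int affine_hyperplane)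
  moreover have "range (E 1 2) \<subseteq> {x. n 0 \<bullet> x = k1} \<inter> {x. m 0 \<bullet> x = k3}"
    using nE mE by auto
  ultimately show ?thesis
    by blast
qed

text \<open>
Along the arc length of the original curve the indicatrix has speed \<open>k2\<close>; the numbers \<open>K\<close>, \<open>L\<close>, \<open>M\<close>
are its three curvatures multiplied by that speed. The relation \<open>L\<^sup>2 + M\<^sup>2 = K\<^sup>2\<close> is the source
of the factor \<open>\<surd>2\<close> in the comparison of total curvatures.\<close>

definition K :: real where "K = sqrt (k1\<^sup>2 + k2\<^sup>2 + k3\<^sup>2)"
definition L :: real where "L = 2 * k1 * k3 / K"
definition M :: real where "M = sqrt (K\<^sup>2 - L\<^sup>2)"

lemma K_pos: "K > 0" and K_squared: "K\<^sup>2 = k1\<^sup>2 + k2\<^sup>2 + k3\<^sup>2"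
proof -
  have "k1\<^sup>2 + k2\<^sup>2 + k3\<^sup>2 > 0"
    using k_pos by (simp add: add_pos_pos)
  then show "K > 0" "K\<^sup>2 = k1\<^sup>2 + k2\<^sup>2 + k3\<^sup>2"
    unfolding K_def by (simp_all only: real_sqrt_gt_0_iff real_sqrt_pow2 less_imp_le)
qed

lemma L_pos: "L > 0" and KL: "K * L = 2 * k1 * k3"
  using k_pos K_pos by (simp_all add: L_def)

lemma M_pos: "M > 0" and M_squared: "M\<^sup>2 = K\<^sup>2 - L\<^sup>2"
proof -
  have "L * K < K * K"
    using dual_gap KL K_squared by (simp add: power2_eq_square mult.commute)
  then have "L < K"
    using K_pos by simp
  then have "L\<^sup>2 < K\<^sup>2"
    using L_pos by (intro power_strict_mono) auto
  then show "M > 0" "M\<^sup>2 = K\<^sup>2 - L\<^sup>2"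
    unfolding M_def by simp_all
qed

text \<open>The Frenet frame of the indicatrix: differentiating \<open>e\<^sub>1 \<and> e\<^sub>2\<close> repeatedly and orthonormalizing at each
step. Here \<open>K w\<close> is the derivative of \<open>e\<^sub>1 \<and> e\<^sub>3\<close> and \<open>u\<close> that of \<open>e\<^sub>2 \<and> e\<^sub>4\<close>, while
\<open>u + L w\<close> is the part of \<open>u\<close> orthogonal to \<open>w\<close>.\<close>

definition f :: "nat \<Rightarrow> real \<Rightarrow> real ^ 6" where
  "f i t =
    (let w = inverse K *\<^sub>R (k1 *\<^sub>R E 2 3 t - k2 *\<^sub>R E 1 2 t + k3 *\<^sub>R E 1 4 t);
         u = k2 *\<^sub>R E 3 4 t - k1 *\<^sub>R E 1 4 t - k3 *\<^sub>R E 2 3 t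
     in if i = 1 then E 1 3 t
        else if i = 2 then w
        else if i = 3 then E 2 4 t
        else inverse M *\<^sub>R (u + L *\<^sub>R w))"

lemma f_derivative:
  shows "(E 1 2 has_vector_derivative (v t * k2) *\<^sub>R f 1 t) (at t)"
    and "(f 1 has_vector_derivative (v t * k2) *\<^sub>R ((K / k2) *\<^sub>R f 2 t)) (at t)"
    and "(f 2 has_vector_derivative (v t * k2) *\<^sub>R ((L / k2) *\<^sub>R f 3 t - (K / k2) *\<^sub>R f 1 t)) (at t)"
    and "(f 3 has_vector_derivative (v t * k2) *\<^sub>R ((M / k2) *\<^sub>R f 4 t - (L / k2) *\<^sub>R f 2 t)) (at t)"
proof -
  have ne: "K \<noteq> 0" "M \<noteq> 0" "k2 \<noteq> 0"
    using K_pos M_pos k_pos by auto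
  have f: "f 1 = E 1 3" "f 3 = E 2 4"
    "f 2 = (\<lambda>t. inverse K *\<^sub>R (k1 *\<^sub>R E 2 3 t - k2 *\<^sub>R E 1 2 t + k3 *\<^sub>R E 1 4 t))"
    by (simp_all add: f_def fun_eq_iff)
  have f4: "M *\<^sub>R f 4 t = k2 *\<^sub>R E 3 4 t - k1 *\<^sub>R E 1 4 t - k3 *\<^sub>R E 2 3 t + L *\<^sub>R f 2 t"
    using ne by (simp add: f_def)
  have f2: "K *\<^sub>R f 2 t = k1 *\<^sub>R E 2 3 t - k2 *\<^sub>R E 1 2 t + k3 *\<^sub>R E 1 4 t"
    using ne by (simp add: f)
  show "(E 1 2 has_vector_derivative (v t * k2) *\<^sub>R f 1 t) (at t)"
    using E_derivative(1)[of t] unfolding f(1) by simp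
  have speed1: "v t *\<^sub>R (K *\<^sub>R f 2 t) = (v t * k2) *\<^sub>R ((K / k2) *\<^sub>R f 2 t)"
    using ne by simp
  show "(f 1 has_vector_derivative (v t * k2) *\<^sub>R ((K / k2) *\<^sub>R f 2 t)) (at t)"
    using E_derivative(2)[of t] unfolding f2[symmetric] speed1 f(1) .
  have speed3: "v t *\<^sub>R (M *\<^sub>R f 4 t - L *\<^sub>R f 2 t) = (v t * k2) *\<^sub>R ((M / k2) *\<^sub>R f 4 t - (L / k2) *\<^sub>R f 2 t)"
    using ne by (simp add: scaleR_diff_right)
  show "(f 3 has_vector_derivative (v t * k2) *\<^sub>R ((M / k2) *\<^sub>R f 4 t - (L / k2) *\<^sub>R f 2 t)) (at t)"
    using E_derivative(5)[of t] unfolding speed3[symmetric] f4 f(2) by simp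
  have coeff: "k1 * k1 + k2 * k2 + k3 * k3 = K * K" "k1 * k3 + k1 * k3 = K * L"
    using K_squared KL by (simp_all add: power2_eq_square)
  have "inverse K *\<^sub>R (k1 *\<^sub>R v t *\<^sub>R (k3 *\<^sub>R E 2 4 t - k1 *\<^sub>R E 1 3 t)
      - k2 *\<^sub>R v t *\<^sub>R (k2 *\<^sub>R E 1 3 t) + k3 *\<^sub>R v t *\<^sub>R (k1 *\<^sub>R E 2 4 t - k3 *\<^sub>R E 1 3 t))
     = (inverse K * v t) *\<^sub>R ((k1 * k3 + k1 * k3) *\<^sub>R E 2 4 t - (k1 * k1 + k2 * k2 + k3 * k3) *\<^sub>R E 1 3 t)"
    by (simp only: algebra_simps scaleR_scaleR)
  also have "\<dots> = (inverse K * v t) *\<^sub>R ((K * L) *\<^sub>R E 2 4 t - (K * K) *\<^sub>R E 1 3 t)"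
    unfolding coeff ..
  also have "\<dots> = (v t * k2) *\<^sub>R ((L / k2) *\<^sub>R f 3 t - (K / k2) *\<^sub>R f 1 t)"
    unfolding f(1,2) using ne by (simp add: scaleR_diff_right field_simps)
  finally show "(f 2 has_vector_derivative (v t * k2) *\<^sub>R ((L / k2) *\<^sub>R f 3 t - (K / k2) *\<^sub>R f 1 t)) (at t)"
    unfolding f(3)
    by (rule has_vector_derivative_eq_rhs[OF has_derivative_scaled[OF has_vector_derivative_add[OF has_vector_derivative_diff
            [OF has_derivative_scaled[OF E_derivative(4)] has_derivative_scaled[OF E_derivative(1)]] has_derivative_scaled[OF E_derivative(3)]]]])
qed

lemma f_orthonormal:
  assumes "i \<in> {1..4}" "j \<in> {1..4}"
  shows "f i t \<bullet> f j t = (if i = j then 1 else 0)"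
proof -
  define w where "w = k1 *\<^sub>R E 2 3 t - k2 *\<^sub>R E 1 2 t + k3 *\<^sub>R E 1 4 t"
  define u where "u = k2 *\<^sub>R E 3 4 t - k1 *\<^sub>R E 1 4 t - k3 *\<^sub>R E 2 3 t"
  have f: "f 1 t = E 1 3 t" "f 2 t = inverse K *\<^sub>R w" "f 3 t = E 2 4 t"
    "f 4 t = inverse M *\<^sub>R (u + L *\<^sub>R inverse K *\<^sub>R w)"
    by (simp_all add: f_def w_def u_def Let_def)
  have ww: "w \<bullet> w = K\<^sup>2" and uw: "u \<bullet> w = - (K * L)" and uu: "u \<bullet> u = K\<^sup>2"
    unfolding K_squared KL w_def u_def
    by (simp_all add: inner_add_left inner_add_right inner_diff_left inner_diff_right E_inner power2_eq_square)
  have 0: "w \<bullet> E 1 3 t = 0" "w \<bullet> E 2 4 t = 0" "u \<bullet> E 1 3 t = 0" "u \<bullet> E 2 4 t = 0"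
      "E 1 3 t \<bullet> E 2 4 t = 0" "E 1 3 t \<bullet> E 1 3 t = 1" "E 2 4 t \<bullet> E 2 4 t = 1"
    unfolding w_def u_def
    by (simp_all add: inner_add_left inner_add_right inner_diff_left inner_diff_right E_inner)
  have "f 2 t \<bullet> f 2 t = 1"
    using K_pos by (simp add: f ww power2_eq_square field_simps)
  moreover have "f 4 t \<bullet> f 2 t = 0"
    using K_pos by (simp add: f ww uw inner_add_left power2_eq_square field_simps)
  moreover have "f 4 t \<bullet> f 4 t = 1"
  proof -
    have "(u + L *\<^sub>R inverse K *\<^sub>R w) \<bullet> (u + L *\<^sub>R inverse K *\<^sub>R w) = M\<^sup>2"
      using K_pos unfolding M_squared
      by (simp add: inner_add_left inner_add_right inner_commute[of w u] ww uu uw power2_eq_square field_simps)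
    then have "f 4 t \<bullet> f 4 t = inverse M * (inverse M * M\<^sup>2)"
      by (simp only: f inner_scaleR_left inner_scaleR_right)
    then show ?thesis
      using M_pos by (simp add: power2_eq_square field_simps)
  qed
  moreover have "f 1 t \<bullet> f 1 t = 1" "f 3 t \<bullet> f 3 t = 1" "f 1 t \<bullet> f 3 t = 0"
      "f 2 t \<bullet> f 1 t = 0" "f 2 t \<bullet> f 3 t = 0" "f 4 t \<bullet> f 1 t = 0" "f 4 t \<bullet> f 3 t = 0"
    unfolding f by (simp_all only: 0 inner_add_left inner_scaleR_left inner_scaleR_right)
      simp_all
  moreover have "i \<in> {1, 2, 3, 4}" "j \<in> {1, 2, 3, 4}"
    using assms by auto
  ultimately show ?thesis
    by (auto simp: inner_commute)
qed

lemma norm_f_1: "norm (f 1 t) = 1"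
  by (simp add: norm_eq_1 f_orthonormal)

lemma E12_speed: "norm (curve_deriv (E 1 2) t) = v t * k2"
  using curve_deriv_eqI[OF f_derivative(1)] norm_f_1 v_pos[of t] k_pos by (simp add: abs_mult)

lemma E12_regular: "regular_curve (E 1 2)"
  unfolding regular_curve_def using E12_speed v_pos k_pos
  by (metis less_irrefl mult_pos_pos norm_zero)

lemma E12_curvatures:
  "curvature (E 1 2) 1 t = K / k2" "curvature (E 1 2) 2 t = L / k2" "curvature (E 1 2) 3 t = M / k2"
  by (rule curvatures_of_frame[where f = f and \<kappa>\<^sub>1 = "K / k2" and \<kappa>\<^sub>2 = "L / k2" and \<kappa>\<^sub>3 = "M / k2"];
      (unfold E12_speed)?;
      (rule E12_regular f_derivative divide_pos_pos K_pos L_pos M_pos k_pos | erule (1) f_orthonormal)+)+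

lemma E12_total_curvatures:
  "curvature (E 1 2) 1 t * norm (curve_deriv (E 1 2) t) = K * v t"
  "sqrt ((curvature (E 1 2) 1 t)\<^sup>2 + (curvature (E 1 2) 2 t)\<^sup>2 + (curvature (E 1 2) 3 t)\<^sup>2)
     * norm (curve_deriv (E 1 2) t) = sqrt 2 * (K * v t)"
proof -
  show "curvature (E 1 2) 1 t * norm (curve_deriv (E 1 2) t) = K * v t"
    using k_pos unfolding E12_curvatures E12_speed by simp
  have square_sum: "(K / k2)\<^sup>2 + (L / k2)\<^sup>2 + (M / k2)\<^sup>2 = 2 * (K / k2)\<^sup>2"
    using k_pos M_squared by (simp add: power_divide flip: add_divide_distrib)
  have "sqrt ((K / k2)\<^sup>2 + (L / k2)\<^sup>2 + (M / k2)\<^sup>2) = sqrt 2 * (K / k2)"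
    using K_pos k_pos unfolding square_sum by (simp add: real_sqrt_mult)
  then show "sqrt ((curvature (E 1 2) 1 t)\<^sup>2 + (curvature (E 1 2) 2 t)\<^sup>2 + (curvature (E 1 2) 3 t)\<^sup>2)
     * norm (curve_deriv (E 1 2) t) = sqrt 2 * (K * v t)"
    using k_pos unfolding E12_curvatures E12_speed by simp
qed

end

section \<open>The osculating indicatrix\<close>

lemma is_period_curve_deriv:
  assumes "smooth_curve c" "is_period c T"
  shows "is_period (curve_deriv c) T"
proof -
  have "curve_deriv c (t + T) = curve_deriv c t" for t
  proof -
    have "((\<lambda>s. s + T) has_vector_derivative 1) (at t)"
      by (auto intro!: derivative_eq_intros)
    from vector_diff_chain_at[OF this smooth_curve_has_derivative[OF assms(1)]]
    have "((\<lambda>s. c (s + T)) has_vector_derivative curve_deriv c (t + T)) (at t)"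
      by (simp add: o_def)
    moreover have "(\<lambda>s. c (s + T)) = c"
      using assms(2) by (auto simp: is_period_def)
    ultimately show ?thesis
      by (metis curve_deriv_eqI)
  qed
  then show ?thesis
    using assms(2) by (simp add: is_period_def)
qed

lemma is_period_osculating_indicatrix:
  assumes "smooth_curve c" "is_period c T"
  shows "is_period (osculating_indicatrix c) T"
  using is_period_curve_deriv[OF assms]
    is_period_curve_deriv[OF smooth_curve_curve_deriv[OF assms(1)] is_period_curve_deriv[OF assms]]
  by (simp add: is_period_def osculating_indicatrix_def)

lemma frenet_1:
  assumes "regular_curve c"
  shows "frenet c 1 t = arc_deriv c c t" "norm (frenet c 1 t) = 1"
proof -
  have "norm (arc_deriv c c t) = 1"
    using assms by (simp add: arc_deriv_def regular_curve_def)
  then show "frenet c 1 t = arc_deriv c c t" "norm (frenet c 1 t) = 1"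
    unfolding frenet_def by (subst gram_schmidt.simps; simp add: sgn_div_norm)+
qed

text \<open>In the basis of the first two frame vectors the velocity has coordinates \<open>(v, 0)\<close> and the
acceleration \<open>(v', v\<^sup>2 \<beta>)\<close> where \<open>\<beta> > 0\<close> is the first curvature. The Pluecker vector of the two is therefore the positive
multiple \<open>v\<^sup>3 \<beta>\<close> of the unit bivector spanned by these frame vectors.\<close>

lemma osculating_indicatrix_eq_pluecker_frenet:
  assumes c: "smooth_curve c" "regular_curve c" and nz: "frenet c 2 t \<noteq> 0"
  shows "osculating_indicatrix c t = pluecker (frenet c 1 t) (frenet c 2 t)"
proof -
  interpret pluecker: bounded_bilinear pluecker
    by (rule bounded_bilinear_pluecker)
  let ?v = "\<lambda>t. norm (curve_deriv c t)"
  let ?e = "frenet c 1"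
  let ?a = "(arc_deriv c ^^ 2) c t"
  define \<beta> where "\<beta> = ?a \<bullet> frenet c 2 t"
  have v: "?v t > 0"
    using c by (simp add: regular_curve_def)
  have \<beta>: "\<beta> > 0"
    using gram_schmidt_coeff_pos[of "\<lambda>j. (arc_deriv c ^^ j) c t" 2] nz by (simp add: \<beta>_def frenet_def)
  have e: "?e = arc_deriv c c"
    using frenet_1[OF c(2)] by auto
  have "{1..2::nat} = {1, 2}"
    by auto
  then have a: "?a = (?a \<bullet> ?e t) *\<^sub>R ?e t + \<beta> *\<^sub>R frenet c 2 t"
    using frenet_expand[of 2 c t] by (simp add: \<beta>_def)
  have c': "curve_deriv c = (\<lambda>t. ?v t *\<^sub>R ?e t)"
    using c unfolding e by (auto simp: arc_deriv_def regular_curve_def)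
  have "smooth_curve ?e"
    unfolding e by (intro smooth_curve_arc_deriv c)
  moreover have "?a = arc_deriv c ?e t"
    unfolding e by (simp add: numeral_2_eq_2)
  ultimately have "(?e has_vector_derivative ?v t *\<^sub>R ?a) (at t)"
    using has_arc_deriv[OF c(2), of ?e t] by simp
  moreover have "(?v has_vector_derivative curve_deriv ?v t) (at t)"
    using c by (intro smooth_curve_has_derivative smooth_curve_norm smooth_curve_curve_deriv)
      (auto simp: regular_curve_def)
  ultimately have "((\<lambda>t. ?v t *\<^sub>R ?e t) has_vector_derivative
      ?v t *\<^sub>R (?v t *\<^sub>R ?a) + curve_deriv ?v t *\<^sub>R ?e t) (at t)"
    by (intro bounded_bilinear.has_vector_derivative[OF bounded_bilinear_scaleR])
  then have c'': "curve_deriv (curve_deriv c) t = ?v t *\<^sub>R (?v t *\<^sub>R ?a) + curve_deriv ?v t *\<^sub>R ?e t"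
    unfolding c'[symmetric] by (rule curve_deriv_eqI)
  have "pluecker (curve_deriv c t) (curve_deriv (curve_deriv c) t)
      = pluecker (?v t *\<^sub>R ?e t) (curve_deriv (curve_deriv c) t)"
    using c' by metis
  also have "\<dots> = (?v t ^ 3 * \<beta>) *\<^sub>R pluecker (?e t) (frenet c 2 t)"
    unfolding c'' by (subst a) (simp add: pluecker.scaleR_left pluecker.scaleR_right pluecker.add_right
        pluecker_self power3_eq_cube)
  finally have w: "pluecker (curve_deriv c t) (curve_deriv (curve_deriv c) t)
      = (?v t ^ 3 * \<beta>) *\<^sub>R pluecker (?e t) (frenet c 2 t)" .
  have "?e t \<noteq> 0"
    using frenet_1(2)[OF c(2), of t] by auto
  then have "norm (pluecker (?e t) (frenet c 2 t)) = 1"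
    using nz by (simp add: norm_eq_1 pluecker_inner frenet_orthonormal)
  moreover define q where "q = ?v t ^ 3 * \<beta>"
  moreover have "q > 0"
    using v \<beta> by (simp add: q_def)
  ultimately show ?thesis
    using w by (simp add: osculating_indicatrix_def Let_def flip: q_def)
qed

theorem theorem2:
  fixes \<gamma> :: "real \<Rightarrow> real ^ 4"
  defines "\<gamma>' \<equiv> osculating_indicatrix \<gamma>"
  defines "T \<equiv> minimal_period \<gamma>"
  assumes "smooth_closed_curve \<gamma>"
    and "\<forall>i\<in>{1,2,3}. curvature \<gamma> i constant_on UNIV \<and> (\<forall>t. curvature \<gamma> i t \<noteq> 0)"
  shows "smooth_closed_curve \<gamma>' \<and>
    (\<exists>P. affine P \<and> aff_dim P = 4 \<and> range \<gamma>' \<subseteq> P) \<and>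
    (\<forall>i\<in>{1,2,3}. curvature \<gamma>' i constant_on UNIV \<and> (\<forall>t. curvature \<gamma>' i t \<noteq> 0)) \<and>
    arc_integral \<gamma>' T (curvature \<gamma>' 1) =
      arc_integral \<gamma> T (\<lambda>t. sqrt ((curvature \<gamma> 1 t)\<^sup>2 + (curvature \<gamma> 2 t)\<^sup>2 + (curvature \<gamma> 3 t)\<^sup>2)) \<and>
    arc_integral \<gamma>' T (\<lambda>t. sqrt ((curvature \<gamma>' 1 t)\<^sup>2 + (curvature \<gamma>' 2 t)\<^sup>2 + (curvature \<gamma>' 3 t)\<^sup>2)) =
      sqrt 2 * arc_integral \<gamma> T (\<lambda>t. sqrt ((curvature \<gamma> 1 t)\<^sup>2 + (curvature \<gamma> 2 t)\<^sup>2 + (curvature \<gamma> 3 t)\<^sup>2))"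
proof -
  have c: "smooth_curve \<gamma>" "regular_curve \<gamma>"
    using assms(3) by (auto simp: smooth_closed_curve_def)
  obtain k1 k2 k3 where k: "\<And>t. curvature \<gamma> 1 t = k1" "\<And>t. curvature \<gamma> 2 t = k2"
      "\<And>t. curvature \<gamma> 3 t = k3"
    using assms(4) by (auto simp: constant_on_def)
  \<comment> \<open>if \<open>e\<^sub>i\<^sub>+\<^sub>1\<close> were 0, then so would be \<open>k\<^sub>i\<close>, its inner product with the derivative of \<open>e\<^sub>i\<close>\<close>
  have step: "frenet \<gamma> (Suc i) t \<noteq> 0" if "i \<in> {1,2,3}" for i t
    using assms(4) that unfolding curvature_def by (metis inner_zero_right)
  have nz: "frenet \<gamma> j t \<noteq> 0" if "j \<in> {1..4}" for j t
  proof -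
    from that consider "j = 1" | "j = Suc 1" | "j = Suc 2" | "j = Suc 3"
      by fastforce
    then show ?thesis
      using frenet_1(2)[OF c(2), of t] step[of 1 t] step[of 2 t] step[of 3 t] by cases auto
  qed
  have sm: "smooth_curve (frenet \<gamma> j)" if "j \<in> {1..4}" for j
    using that by (intro smooth_curve_frenet c nz) auto
  have d: "(frenet \<gamma> j has_vector_derivative
      norm (curve_deriv \<gamma> t) *\<^sub>R arc_deriv \<gamma> (frenet \<gamma> j) t) (at t)" if "j \<in> {1..4}" for j t
    by (intro has_arc_deriv c sm that)
  have pos: "curvature \<gamma> i t > 0" if "i \<in> {1..3}" for i t
    using that by (intro curvature_pos c nz) auto
  note frenet_eqs = frenet_equations_4[OF _ c nz, unfolded k]
  interpret constant_curvature_frame "\<lambda>t. norm (curve_deriv \<gamma> t)" "frenet \<gamma>" k1 k2 k3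
  proof
    show "norm (curve_deriv \<gamma> t) > 0" for t
      using c by (simp add: regular_curve_def)
    show "k1 > 0" "k2 > 0" "k3 > 0"
      using pos[of 1 0] pos[of 2 0] pos[of 3 0] unfolding k by simp_all
    show "frenet \<gamma> i t \<bullet> frenet \<gamma> j t = (if i = j then 1 else 0)" if "i \<in> {1..4}" "j \<in> {1..4}" for i j t
      using that nz by (intro frenet_orthonormal) auto
    show "(frenet \<gamma> 1 has_vector_derivative norm (curve_deriv \<gamma> t) *\<^sub>R (k1 *\<^sub>R frenet \<gamma> 2 t)) (at t)" for t
      using d[of 1 t] frenet_eqs(1)[of t] by simp
    show "(frenet \<gamma> 2 has_vector_derivative
        norm (curve_deriv \<gamma> t) *\<^sub>R (k2 *\<^sub>R frenet \<gamma> 3 t - k1 *\<^sub>R frenet \<gamma> 1 t)) (at t)" for t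
      using d[of 2 t] frenet_eqs(2)[of t] by simp
    show "(frenet \<gamma> 3 has_vector_derivative
        norm (curve_deriv \<gamma> t) *\<^sub>R (k3 *\<^sub>R frenet \<gamma> 4 t - k2 *\<^sub>R frenet \<gamma> 2 t)) (at t)" for t
      using d[of 3 t] frenet_eqs(3)[of t] by simp
    show "(frenet \<gamma> 4 has_vector_derivative
        norm (curve_deriv \<gamma> t) *\<^sub>R (- k3 *\<^sub>R frenet \<gamma> 3 t)) (at t)" for t
      using d[of 4 t] frenet_eqs(4)[of t] by simp
  qed
  have \<gamma>': "\<gamma>' = E 1 2"
    unfolding \<gamma>'_def using nz
    by (auto simp only: fun_eq_iff E_def intro!: osculating_indicatrix_eq_pluecker_frenet c) auto
  have "smooth_curve \<gamma>'"
    unfolding \<gamma>' E_def[abs_def] by (rule smooth_curve_bilinear[OF bounded_bilinear_pluecker sm sm]) auto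
  moreover obtain T0 where "is_period \<gamma> T0"
    using assms(3) by (auto simp: smooth_closed_curve_def)
  then have "is_period \<gamma>' T0"
    unfolding \<gamma>'_def by (intro is_period_osculating_indicatrix c)
  ultimately have closed: "smooth_closed_curve \<gamma>'"
    using E12_regular by (auto simp: smooth_closed_curve_def \<gamma>')
  have curv: "\<forall>i\<in>{1,2,3}. curvature \<gamma>' i constant_on UNIV \<and> (\<forall>t. curvature \<gamma>' i t \<noteq> 0)"
    unfolding \<gamma>' constant_on_def using K_pos L_pos M_pos k_pos
    by (simp only: ball_simps E12_curvatures) simp
  have K: "sqrt ((curvature \<gamma> 1 t)\<^sup>2 + (curvature \<gamma> 2 t)\<^sup>2 + (curvature \<gamma> 3 t)\<^sup>2) = K" for t
    unfolding k K_def ..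
  have "arc_integral \<gamma>' T (curvature \<gamma>' 1) = arc_integral \<gamma> T (\<lambda>t. K)"
    unfolding arc_integral_def \<gamma>' E12_total_curvatures ..
  moreover have "arc_integral \<gamma>' T (\<lambda>t. sqrt ((curvature \<gamma>' 1 t)\<^sup>2 + (curvature \<gamma>' 2 t)\<^sup>2 + (curvature \<gamma>' 3 t)\<^sup>2)) =
      sqrt 2 * arc_integral \<gamma> T (\<lambda>t. K)"
    unfolding arc_integral_def \<gamma>' E12_total_curvatures by (rule integral_mult_right)
  ultimately show ?thesis
    unfolding K using closed curv E12_in_4_plane \<gamma>' by simp
qed

end
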